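(* For a $k$-space $X$ the following conditions are equivalent: (i) $X$ is a $\mathfrak P_0$-space; (ii) $X$ is an $\aleph_0$-space; (iii) $X$ is a regular space with a countable $\mathrm{cs}^*$-network.
   Context: Compactness does not include any separation axiom; "regular" means $T_3$. A topological space $X$ is a $k$-space if for each non-closed subset $A\subset X$ there is a compact subset $K\subset X$ such that $K\cap A$ is not closed in $K$. A subset $A$ of a topological space $X$ accumulates at a point $x\in X$ if each neighborhood of $x$ contains infinitely many points of $A$. A family $\mathcal N$ of subsets of $X$ is a network at $x\in X$ if for any neighborhood $O_x$ of $x$ there is $N\in\mathcal N$ with $x\in N\subset O_x$. It is a Pytkeev network at $x$ if it is a network at $x$ and for each neighborhood $O_x$ of $x$ and each subset $A\subset X$ accumulating at $x$ there is $N\in\mathcal N$ such that $N\subset O_x$ and $N\cap A$ is infinite. It is a Pytkeev network for $X$ if it is a Pytkeev network at each point $x\in X$. A family $\mathcal N$ of subsets of $X$ is a $k$-network if for each open set $U\subset X$ and each compact subset $K\subset U$ there is a finite subfamily $\mathcal F\subset\mathcal N$ such that $K\subset\bigcup\mathcal F\subset U$. It is a $\mathrm{cs}^*$-network if for each $x\in X$, each sequence $(x_n)_{n\in\omega}$ in $X$ convergent to $x$ and each neighborhood $O_x$ of $x$ there is $N\in\mathcal N$ such that $N\subset O_x$ and the set $\{n\in\omega: x_n\in N\}$ is infinite. A $\mathfrak P_0$-space is a regular space with a countable Pytkeev network. An $\aleph_0$-space is a regular space with a countable $k$-network. *)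

theory Defs
  imports "HOL-Analysis.Analysis"
begin

text \<open>Conventions: a neighbourhood of a point is an open set containing it, and families of
  subsets of \<open>X\<close> are required to consist of subsets of the carrier \<open>topspace X\<close>.
  The library's \<open>compactin\<close> and \<open>k_space\<close> assume no separation.\<close>

text \<open>The library's \<open>regular_space\<close> does not include any axiom separating points.\<close>

definition t3_space :: "'a topology \<Rightarrow> bool" where
  "t3_space X \<longleftrightarrow> regular_space X \<and> t1_space X"

definition accumulates_at :: "'a topology \<Rightarrow> 'a set \<Rightarrow> 'a \<Rightarrow> bool" where
  "accumulates_at X A x \<longleftrightarrow> (\<forall>U. openin X U \<and> x \<in> U \<longrightarrow> infinite (U \<inter> A))"

definition network_at :: "'a topology \<Rightarrow> 'a set set \<Rightarrow> 'a \<Rightarrow> bool" where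
  "network_at X \<N> x \<longleftrightarrow> \<N> \<subseteq> Pow (topspace X) \<and>
     (\<forall>U. openin X U \<and> x \<in> U \<longrightarrow> (\<exists>N\<in>\<N>. x \<in> N \<and> N \<subseteq> U))"

definition Pytkeev_network_at :: "'a topology \<Rightarrow> 'a set set \<Rightarrow> 'a \<Rightarrow> bool" where
  "Pytkeev_network_at X \<N> x \<longleftrightarrow> network_at X \<N> x \<and>
     (\<forall>U A. openin X U \<and> x \<in> U \<and> A \<subseteq> topspace X \<and> accumulates_at X A x \<longrightarrow>
        (\<exists>N\<in>\<N>. N \<subseteq> U \<and> infinite (N \<inter> A)))"

definition Pytkeev_network :: "'a topology \<Rightarrow> 'a set set \<Rightarrow> bool" where
  "Pytkeev_network X \<N> \<longleftrightarrow> \<N> \<subseteq> Pow (topspace X) \<and>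
     (\<forall>x\<in>topspace X. Pytkeev_network_at X \<N> x)"

definition k_network :: "'a topology \<Rightarrow> 'a set set \<Rightarrow> bool" where
  "k_network X \<N> \<longleftrightarrow> \<N> \<subseteq> Pow (topspace X) \<and>
     (\<forall>U K. openin X U \<and> compactin X K \<and> K \<subseteq> U \<longrightarrow>
        (\<exists>\<F>. finite \<F> \<and> \<F> \<subseteq> \<N> \<and> K \<subseteq> \<Union>\<F> \<and> \<Union>\<F> \<subseteq> U))"

text \<open>The library's \<open>limitin\<close> only forces a sequence to lie in the carrier eventually, whence the
  explicit range condition.\<close>

definition cs_star_network :: "'a topology \<Rightarrow> 'a set set \<Rightarrow> bool" where
  "cs_star_network X \<N> \<longleftrightarrow> \<N> \<subseteq> Pow (topspace X) \<and>
     (\<forall>x\<in>topspace X. \<forall>s :: nat \<Rightarrow> 'a. range s \<subseteq> topspace X \<and> limitin X s x sequentially \<longrightarrow>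
        (\<forall>U. openin X U \<and> x \<in> U \<longrightarrow> (\<exists>N\<in>\<N>. N \<subseteq> U \<and> infinite {n. s n \<in> N})))"

definition P0_space :: "'a topology \<Rightarrow> bool" where
  "P0_space X \<longleftrightarrow> t3_space X \<and> (\<exists>\<N>. countable \<N> \<and> Pytkeev_network X \<N>)"

definition aleph0_space :: "'a topology \<Rightarrow> bool" where
  "aleph0_space X \<longleftrightarrow> t3_space X \<and> (\<exists>\<N>. countable \<N> \<and> k_network X \<N>)"

end

theory Submission
  imports Defs
begin

text \<open>The equivalence is proved as a cycle.

  A countable \<open>k\<close>-network of a \<open>T\<^sub>3\<close> \<open>k\<close>-space is itself a Pytkeev network. If a set \<open>A\<close> accumulates
  at \<open>x\<close> and \<open>U\<close> is a neighbourhood of \<open>x\<close>, choose by regularity an open \<open>V\<close> and a closed \<open>C\<close> with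
  \<open>x \<in> V \<subseteq> C \<subseteq> U\<close>. The set \<open>A \<inter> V - {x}\<close> is not closed, so some compact \<open>K\<close> witnesses this, and
  as finite sets are closed, \<open>K\<close> meets \<open>A \<inter> V\<close> in an infinite set. The compact set \<open>K \<inter> C\<close> lies in
  \<open>U\<close> and is covered by finitely many network members inside \<open>U\<close>, one of which must contain
  infinitely many points of \<open>A\<close>. No convergent sequence is involved.

  A Pytkeev network of a \<open>T\<^sub>1\<close>-space is a \<open>cs\<^sup>*\<close>-network: a convergent sequence either takes the value
  of its limit infinitely often, or its range accumulates at the limit.

  Finally, a countable \<open>cs\<^sup>*\<close>-network of a Hausdorff space is a \<open>k\<close>-network. The point is that compact
  sets are sequentially compact, because a \<open>cs\<^sup>*\<close>-network is a network and a countable network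
  separates each point from all others by countably many neighbourhoods. So if no finite number of
  members inside \<open>U\<close> covered a compact \<open>K \<subseteq> U\<close>, points of \<open>K\<close> escaping longer and longer initial
  segments of an enumeration of these members would have a convergent subsequence, and some member
  would have to catch infinitely many of its terms.\<close>

section \<open>From k-networks to Pytkeev networks\<close>

lemma t3_imp_Hausdorff_space: "t3_space X \<Longrightarrow> Hausdorff_space X"
  by (simp add: t3_space_def regular_t1_imp_Hausdorff_space)

lemma accumulates_at_imp_not_closedin:
  assumes "openin X V" "x \<in> V" "accumulates_at X A x"
  shows "\<not> closedin X (A \<inter> V - {x})"
proof
  assume "closedin X (A \<inter> V - {x})"
  then have "openin X (V - (A \<inter> V - {x}))"
    using assms(1) by blast
  moreover have "x \<in> V - (A \<inter> V - {x})"
    using assms(2) by blast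
  ultimately have "infinite ((V - (A \<inter> V - {x})) \<inter> A)"
    using assms(3) unfolding accumulates_at_def by blast
  moreover have "(V - (A \<inter> V - {x})) \<inter> A \<subseteq> {x}"
    by blast
  ultimately show False
    by (meson finite.emptyI finite_insert finite_subset)
qed

lemma k_network_imp_network_at:
  assumes "k_network X \<N>" "x \<in> topspace X"
  shows "network_at X \<N> x"
  unfolding network_at_def
proof (intro conjI allI impI)
  show "\<N> \<subseteq> Pow (topspace X)"
    using assms(1) by (simp add: k_network_def)
  fix U
  assume U: "openin X U \<and> x \<in> U"
  have "compactin X {x}"
    using assms(2) by simp
  moreover have "{x} \<subseteq> U"
    using U by simp
  ultimately obtain \<F> where \<F>: "\<F> \<subseteq> \<N>" "{x} \<subseteq> \<Union>\<F>" "\<Union>\<F> \<subseteq> U"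
    using assms(1) U unfolding k_network_def by meson
  then obtain N where "N \<in> \<F>" "x \<in> N"
    by blast
  then show "\<exists>N\<in>\<N>. x \<in> N \<and> N \<subseteq> U"
    using \<F> by (metis Union_upper subset_trans subsetD)
qed

text \<open>Replacing \<open>A\<close> by its trace on a neighbourhood \<open>V\<close> whose closure stays in \<open>U\<close> is what keeps the
  compact set provided by the \<open>k\<close>-space property under control: that set may be far from \<open>x\<close>.\<close>

lemma k_network_imp_Pytkeev_network:
  assumes "k_space X" "t3_space X" "k_network X \<N>"
  shows "Pytkeev_network X \<N>"
proof -
  have catch: "\<exists>N\<in>\<N>. N \<subseteq> U \<and> infinite (N \<inter> A)"
    if U: "openin X U" "x \<in> U" and A: "A \<subseteq> topspace X" "accumulates_at X A x" for x U A
  proof -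
    obtain V C where VC: "openin X V" "closedin X C" "x \<in> V" "V \<subseteq> C" "C \<subseteq> U"
    proof -
      have "neighbourhood_base_of (closedin X) X"
        using assms(2) by (simp add: t3_space_def neighbourhood_base_of_closedin)
      then show thesis
        using that U unfolding neighbourhood_base_of by meson
    qed
    have "\<not> closedin X (A \<inter> V - {x})"
      using accumulates_at_imp_not_closedin VC A by metis
    moreover have "A \<inter> V - {x} \<subseteq> topspace X"
      using A by blast
    ultimately obtain K where K: "compactin X K"
      and not_closed: "\<not> closedin (subtopology X K) (K \<inter> (A \<inter> V - {x}))"
      using assms(1) unfolding k_space_def by blast
    have inf: "infinite (K \<inter> (A \<inter> V - {x}))"
    proof
      assume fin: "finite (K \<inter> (A \<inter> V - {x}))"
      moreover have "t1_space (subtopology X K)"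
        using assms(2) by (simp add: t3_space_def t1_space_subtopology)
      moreover have "K \<inter> (A \<inter> V - {x}) \<subseteq> topspace (subtopology X K)"
        using A by auto
      ultimately show False
        using not_closed by (metis t1_space_closedin_finite)
    qed
    have "compactin X (K \<inter> C)"
      using K VC(2) by (simp add: closed_Int_compactin Int_commute)
    moreover have "K \<inter> C \<subseteq> U"
      using VC by blast
    ultimately obtain \<F> where \<F>: "finite \<F>" "\<F> \<subseteq> \<N>" "K \<inter> C \<subseteq> \<Union>\<F>" "\<Union>\<F> \<subseteq> U"
      using assms(3) U(1) unfolding k_network_def by meson
    have "K \<inter> (A \<inter> V - {x}) \<subseteq> (\<Union>N\<in>\<F>. N \<inter> A)"
      using \<F>(3) VC(4) by blast
    then have "infinite (\<Union>N\<in>\<F>. N \<inter> A)"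
      using inf finite_subset by blast
    then obtain N where "N \<in> \<F>" "infinite (N \<inter> A)"
      using \<F>(1) by blast
    then show ?thesis
      using \<F> by blast
  qed
  have "Pytkeev_network_at X \<N> x" if "x \<in> topspace X" for x
    unfolding Pytkeev_network_at_def
  proof (intro conjI allI impI)
    show "network_at X \<N> x"
      using k_network_imp_network_at assms(3) that .
    show "\<exists>N\<in>\<N>. N \<subseteq> U \<and> infinite (N \<inter> A)"
      if "openin X U \<and> x \<in> U \<and> A \<subseteq> topspace X \<and> accumulates_at X A x" for U A
      using catch[of U x A] that by simp
  qed
  moreover have "\<N> \<subseteq> Pow (topspace X)"
    using assms(3) by (simp add: k_network_def)
  ultimately show ?thesis
    by (simp add: Pytkeev_network_def)
qed

section \<open>From Pytkeev networks to cs*-networks\<close>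

text \<open>A sequence that hits its limit only finitely often hits every value only finitely often, as
  in a \<open>T\<^sub>1\<close>-space a point other than the limit is avoided by some tail.\<close>

lemma convergent_sequence_accumulates:
  assumes "t1_space X" "range s \<subseteq> topspace X" "limitin X s x sequentially"
    and "finite {n. s n = x}"
  shows "accumulates_at X (range s) x"
proof -
  have x: "x \<in> topspace X"
    using assms(3) by (simp add: limitin_topspace)
  have fib: "finite {n. s n = y}" for y
  proof (cases "y = x \<or> y \<notin> topspace X")
    case True
    then show ?thesis
    proof
      assume "y \<notin> topspace X"
      then have "{n. s n = y} = {}"
        using assms(2) by auto
      then show ?thesis
        by simp
    qed (use assms(4) in simp)
  next
    case False
    then obtain U where "openin X U" "x \<in> U" "y \<notin> U"
      using assms(1) x unfolding t1_space_def by metis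
    then have "\<forall>\<^sub>F n in sequentially. s n \<noteq> y"
      using assms(3) unfolding limitin_def by (metis (mono_tags, lifting) eventually_mono)
    then show ?thesis
      by (simp add: eventually_cofinite flip: cofinite_eq_sequentially)
  qed
  show ?thesis
    unfolding accumulates_at_def
  proof (intro allI impI notI)
    fix U
    assume "openin X U \<and> x \<in> U" and fin: "finite (U \<inter> range s)"
    then have "\<forall>\<^sub>F n in sequentially. s n \<in> U"
      using assms(3) unfolding limitin_def by blast
    then have "finite {n. s n \<notin> U}"
      by (simp add: eventually_cofinite flip: cofinite_eq_sequentially)
    moreover have "finite (\<Union>y \<in> U \<inter> range s. {n. s n = y})"
      using fin fib by blast
    moreover have "UNIV = {n. s n \<notin> U} \<union> (\<Union>y \<in> U \<inter> range s. {n. s n = y})"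
      by auto
    ultimately show False
      by (metis finite_UnI infinite_UNIV_nat)
  qed
qed

lemma Pytkeev_network_imp_cs_star_network:
  assumes "t1_space X" "Pytkeev_network X \<N>"
  shows "cs_star_network X \<N>"
proof -
  have "\<exists>N\<in>\<N>. N \<subseteq> U \<and> infinite {n. s n \<in> N}"
    if x: "x \<in> topspace X" and s: "range s \<subseteq> topspace X" "limitin X s x sequentially"
      and U: "openin X U" "x \<in> U" for x U and s :: "nat \<Rightarrow> 'a"
  proof (cases "finite {n. s n = x}")
    case True
    then have "accumulates_at X (range s) x"
      using convergent_sequence_accumulates assms(1) s by metis
    then obtain N where N: "N \<in> \<N>" "N \<subseteq> U" "infinite (N \<inter> range s)"
      using assms(2) x s(1) U unfolding Pytkeev_network_def Pytkeev_network_at_def by meson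
    have "N \<inter> range s \<subseteq> s ` {n. s n \<in> N}"
      by auto
    then have "infinite {n. s n \<in> N}"
      using N(3) finite_surj by blast
    then show ?thesis
      using N by blast
  next
    case False
    obtain N where N: "N \<in> \<N>" "x \<in> N" "N \<subseteq> U"
      using assms(2) x U unfolding Pytkeev_network_def Pytkeev_network_at_def network_at_def
      by meson
    then have "{n. s n = x} \<subseteq> {n. s n \<in> N}"
      by auto
    then show ?thesis
      using False N finite_subset by blast
  qed
  then show ?thesis
    using assms(2) by (simp add: cs_star_network_def Pytkeev_network_def)
qed

section \<open>Sequential compactness from a countable network\<close>

lemma compactin_sequence_cluster_point:
  assumes "compactin X K" "infinite I" "\<And>n. n \<in> I \<Longrightarrow> s n \<in> K"
  obtains y where "y \<in> K" "\<And>U. openin X U \<Longrightarrow> y \<in> U \<Longrightarrow> infinite {n \<in> I. s n \<in> U}"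
proof -
  have "\<exists>y\<in>K. \<forall>U. openin X U \<and> y \<in> U \<longrightarrow> infinite {n \<in> I. s n \<in> U}"
  proof (rule ccontr)
    assume contra: "\<not> ?thesis"
    define \<U> where "\<U> = {U. openin X U \<and> finite {n \<in> I. s n \<in> U}}"
    have "K \<subseteq> \<Union>\<U>"
      using contra unfolding \<U>_def by blast
    moreover have "\<forall>U\<in>\<U>. openin X U"
      by (simp add: \<U>_def)
    ultimately obtain \<F> where \<F>: "finite \<F>" "\<F> \<subseteq> \<U>" "K \<subseteq> \<Union>\<F>"
      using assms(1) unfolding compactin_def by meson
    have "I \<subseteq> (\<Union>U\<in>\<F>. {n \<in> I. s n \<in> U})"
      using assms(3) \<F>(3) by blast
    moreover have "finite (\<Union>U\<in>\<F>. {n \<in> I. s n \<in> U})"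
      using \<F>(1,2) unfolding \<U>_def by blast
    ultimately show False
      using assms(2) finite_subset by blast
  qed
  then show ?thesis
    using that by blast
qed

text \<open>Only those network members matter that can be separated from \<open>x\<close> by disjoint open sets; one
  neighbourhood of \<open>x\<close> is chosen for each of them. By the Hausdorff property and the network
  property these members cover everything except \<open>x\<close>.\<close>

lemma Hausdorff_countable_network_separating_nbhds:
  assumes "Hausdorff_space X" "countable \<N>" "\<And>y. y \<in> topspace X \<Longrightarrow> network_at X \<N> y"
    and "x \<in> topspace X"
  obtains V :: "nat \<Rightarrow> 'a set" where "\<And>n. openin X (V n)" "\<And>n. x \<in> V n"
    "\<And>y. y \<in> topspace X \<Longrightarrow> y \<noteq> x \<Longrightarrow> \<exists>n W. openin X W \<and> y \<in> W \<and> disjnt W (V n)"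
proof -
  define sep where "sep N V \<longleftrightarrow> openin X V \<and> x \<in> V \<and>
    (\<exists>W. openin X W \<and> N \<subseteq> W \<and> disjnt W V)" for N V
  define \<P> where "\<P> = {N \<in> \<N>. \<exists>V. sep N V}"
  define v where "v N = (SOME V. sep N V)" for N
  have v: "sep N (v N)" if "N \<in> \<P>" for N
    using that someI_ex unfolding \<P>_def v_def by fast
  \<comment> \<open>The whole space is added to have something to enumerate when \<open>x\<close> is the only point.\<close>
  define \<V> where "\<V> = insert (topspace X) (v ` \<P>)"
  have \<V>: "openin X V \<and> x \<in> V" if "V \<in> \<V>" for V
    using that v assms(4) unfolding \<V>_def sep_def by blast
  have cnt: "countable \<V>"
    using assms(2) unfolding \<V>_def \<P>_def by simp
  have range: "range (from_nat_into \<V>) = \<V>"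
    using cnt unfolding \<V>_def by (intro range_from_nat_into) auto
  show ?thesis
  proof (rule that)
    show "openin X (from_nat_into \<V> n)" "x \<in> from_nat_into \<V> n" for n
      using \<V> range by blast+
    fix y
    assume y: "y \<in> topspace X" "y \<noteq> x"
    then obtain W V where WV: "openin X W" "openin X V" "y \<in> W" "x \<in> V" "disjnt W V"
      using assms(1,4) unfolding Hausdorff_space_def by metis
    obtain N where N: "N \<in> \<N>" "y \<in> N" "N \<subseteq> W"
      using assms(3)[OF y(1)] WV unfolding network_at_def by blast
    then have "N \<in> \<P>"
      using WV unfolding \<P>_def sep_def by blast
    then obtain W' where "openin X W'" "N \<subseteq> W'" "disjnt W' (v N)"
      using v[of N] unfolding sep_def by blast
    moreover have "v N \<in> \<V>"
      using \<open>N \<in> \<P>\<close> by (simp add: \<V>_def)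
    then obtain n where "from_nat_into \<V> n = v N"
      using range by (metis imageE)
    ultimately show "\<exists>n W. openin X W \<and> y \<in> W \<and> disjnt W (from_nat_into \<V> n)"
      using N(2) by (metis subsetD)
  qed
qed

text \<open>Around a cluster point \<open>x\<close> of the sequence, a subsequence is chosen that is eventually in each
  of the countably many separating neighbourhoods. It has no cluster point besides \<open>x\<close>, and in a
  compact set this forces convergence to \<open>x\<close>.\<close>

lemma compactin_convergent_subsequence:
  fixes s :: "nat \<Rightarrow> 'a"
  assumes "Hausdorff_space X" "countable \<N>" "\<And>y. y \<in> topspace X \<Longrightarrow> network_at X \<N> y"
    and K: "compactin X K" "range s \<subseteq> K"
  obtains x r where "x \<in> K" "strict_mono r" "limitin X (s \<circ> r) x sequentially"
proof -
  obtain x where x: "x \<in> K"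
    and clus: "\<And>U. openin X U \<Longrightarrow> x \<in> U \<Longrightarrow> infinite {n \<in> UNIV. s n \<in> U}"
    using compactin_sequence_cluster_point[OF K(1) infinite_UNIV_nat, of s] K(2) by blast
  have KX: "K \<subseteq> topspace X"
    using K(1) compactin_subset_topspace by blast
  obtain V :: "nat \<Rightarrow> 'a set" where V: "\<And>n. openin X (V n)" "\<And>n. x \<in> V n"
    "\<And>y. y \<in> topspace X \<Longrightarrow> y \<noteq> x \<Longrightarrow> \<exists>n W. openin X W \<and> y \<in> W \<and> disjnt W (V n)"
    using Hausdorff_countable_network_separating_nbhds[OF assms(1-3)] x KX by blast
  define B where "B n = (\<Inter>j\<le>n. V j)" for n :: nat
  have B: "openin X (B n)" "x \<in> B n" for n
    unfolding B_def using V(1,2) by (auto intro!: openin_Inter)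
  have later: "\<exists>m>k. s m \<in> B n" for k n
    using clus[OF B] by (auto simp: infinite_nat_iff_unbounded)
  obtain r :: "nat \<Rightarrow> nat" where r: "\<And>n. s (r n) \<in> B n" "\<And>n. r n < r (Suc n)"
  proof -
    have "\<exists>r. \<forall>n. s (r n) \<in> B n \<and> r n < r (Suc n)"
      by (rule dependent_nat_choice) (use later in blast)+
    then show thesis
      using that by blast
  qed
  have "limitin X (s \<circ> r) x sequentially"
    unfolding limitin_def
  proof (intro conjI allI impI)
    show "x \<in> topspace X"
      using x KX by blast
    fix U
    assume U: "openin X U \<and> x \<in> U"
    have "finite {n. s (r n) \<notin> U}" (is "finite ?I")
    proof (rule ccontr)
      assume "infinite ?I"
      moreover have "(s \<circ> r) n \<in> K" for n
        using K(2) by auto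
      ultimately obtain y where y: "y \<in> K"
        "\<And>W. openin X W \<Longrightarrow> y \<in> W \<Longrightarrow> infinite {n \<in> ?I. (s \<circ> r) n \<in> W}"
        using compactin_sequence_cluster_point[OF K(1)] by metis
      have "{n \<in> ?I. (s \<circ> r) n \<in> U} = {}"
        by auto
      then have "y \<noteq> x"
        using y(2)[of U] U by force
      then obtain j W where W: "openin X W" "y \<in> W" "disjnt W (V j)"
        using V(3)[of y] y(1) KX by blast
      have "s (r n) \<in> V j" if "j \<le> n" for n
        using r(1)[of n] that unfolding B_def by blast
      then have "{n \<in> ?I. (s \<circ> r) n \<in> W} \<subseteq> {..<j}"
        using W(3) by (force simp: disjnt_iff not_le[symmetric])
      then show False
        using y(2)[OF W(1,2)] finite_subset by blast
    qed
    then show "\<forall>\<^sub>F n in sequentially. (s \<circ> r) n \<in> U"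
      by (simp add: eventually_cofinite flip: cofinite_eq_sequentially)
  qed
  moreover have "strict_mono r"
    using r(2) by (simp add: strict_mono_Suc_iff)
  ultimately show ?thesis
    using that x by blast
qed

section \<open>From cs*-networks to k-networks\<close>

lemma cs_star_network_imp_network_at:
  assumes "cs_star_network X \<N>" "x \<in> topspace X"
  shows "network_at X \<N> x"
  unfolding network_at_def
proof (intro conjI allI impI)
  show "\<N> \<subseteq> Pow (topspace X)"
    using assms(1) by (simp add: cs_star_network_def)
  fix U
  assume U: "openin X U \<and> x \<in> U"
  have "range (\<lambda>n::nat. x) \<subseteq> topspace X \<and> limitin X (\<lambda>n::nat. x) x sequentially"
    using assms(2) by auto
  then obtain N where N: "N \<in> \<N>" "N \<subseteq> U" "infinite {n::nat. x \<in> N}"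
    using assms U unfolding cs_star_network_def by meson
  then have "x \<in> N"
    using not_finite_existsD by blast
  then show "\<exists>N\<in>\<N>. x \<in> N \<and> N \<subseteq> U"
    using N by blast
qed

lemma cs_star_network_imp_k_network:
  assumes "Hausdorff_space X" "countable \<N>" "cs_star_network X \<N>"
  shows "k_network X \<N>"
proof -
  have "\<exists>\<F>. finite \<F> \<and> \<F> \<subseteq> \<N> \<and> K \<subseteq> \<Union>\<F> \<and> \<Union>\<F> \<subseteq> U"
    if U: "openin X U" and K: "compactin X K" "K \<subseteq> U" for U K
  proof (rule ccontr)
    assume contra: "\<not> ?thesis"
    \<comment> \<open>The empty set makes the family nonempty, so that it can be enumerated.\<close>
    define \<M> where "\<M> = insert {} {N \<in> \<N>. N \<subseteq> U}"
    have "countable \<M>"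
      using assms(2) unfolding \<M>_def by simp
    then have range: "range (from_nat_into \<M>) = \<M>"
      unfolding \<M>_def by (intro range_from_nat_into) auto
    have "\<exists>p. p \<in> K \<and> (\<forall>j\<le>n. p \<notin> from_nat_into \<M> j)" for n
    proof -
      define \<F> where "\<F> = from_nat_into \<M> ` {..n} - {{}}"
      have "\<F> \<subseteq> \<M> - {{}}"
        using range unfolding \<F>_def by blast
      then have "\<F> \<subseteq> \<N>" "\<Union>\<F> \<subseteq> U"
        unfolding \<M>_def by blast+
      moreover have "finite \<F>"
        by (simp add: \<F>_def)
      ultimately have "\<not> K \<subseteq> \<Union>\<F>"
        using contra by metis
      then obtain p where "p \<in> K" "p \<notin> \<Union>\<F>"
        by blast
      then show ?thesis
        unfolding \<F>_def by blast
    qed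
    then obtain s where s: "\<And>n. s n \<in> K" "\<And>n j. j \<le> n \<Longrightarrow> s n \<notin> from_nat_into \<M> j"
      by metis
    obtain x r where x: "x \<in> K" and r: "strict_mono r"
      and lim: "limitin X (s \<circ> r) x sequentially"
      using compactin_convergent_subsequence[OF assms(1,2) cs_star_network_imp_network_at K(1), of s]
        assms(3) s(1) by blast
    have "range (s \<circ> r) \<subseteq> topspace X"
      using s(1) compactin_subset_topspace[OF K(1)] by auto
    then obtain N where N: "N \<in> \<N>" "N \<subseteq> U" "infinite {n. (s \<circ> r) n \<in> N}"
      using assms(3) lim U K x limitin_topspace[OF lim] unfolding cs_star_network_def
      by (meson subsetD)
    then have "N \<in> \<M>"
      by (simp add: \<M>_def)
    then obtain j where j: "from_nat_into \<M> j = N"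
      using range by (metis imageE)
    have "n < j" if "s (r n) \<in> N" for n
      using s(2)[of j "r n"] that j seq_suble[OF r, of n] by (metis le_trans not_le)
    then have "{n. (s \<circ> r) n \<in> N} \<subseteq> {..<j}"
      by auto
    then show False
      using N(3) finite_subset by blast
  qed
  moreover have "\<N> \<subseteq> Pow (topspace X)"
    using assms(3) by (simp add: cs_star_network_def)
  ultimately show ?thesis
    by (simp add: k_network_def)
qed

section \<open>The equivalence\<close>

theorem corollary1p10:
  fixes X :: "'a topology"
  assumes "k_space X"
  shows "(P0_space X \<longleftrightarrow> aleph0_space X) \<and>
         (aleph0_space X \<longleftrightarrow> t3_space X \<and> (\<exists>\<N>. countable \<N> \<and> cs_star_network X \<N>))"
proof -
  have "aleph0_space X \<Longrightarrow> P0_space X"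
    using k_network_imp_Pytkeev_network[OF assms]
    unfolding aleph0_space_def P0_space_def by blast
  moreover have "P0_space X \<Longrightarrow> t3_space X \<and> (\<exists>\<N>. countable \<N> \<and> cs_star_network X \<N>)"
    using Pytkeev_network_imp_cs_star_network unfolding P0_space_def t3_space_def by blast
  moreover have "t3_space X \<and> (\<exists>\<N>. countable \<N> \<and> cs_star_network X \<N>) \<Longrightarrow> aleph0_space X"
    using cs_star_network_imp_k_network t3_imp_Hausdorff_space
    unfolding aleph0_space_def by blast
  ultimately show ?thesis
    by blast
qed

end
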